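(* Let $k\in\mathbb{N}$, $R>0$, $S^k=\{y\in\mathbb{R}^{k+1}:|y|=R\}$, and fix $x\in\mathbb{R}^{k+1}$ with $r=|x|$, $r\neq 0$, $r\neq R$. Suppose $\alpha,\beta\in\mathbb{C}$ satisfy $$\max\{|\operatorname{Im}\alpha|,|\operatorname{Im}\beta|\}\le \frac{\pi/2}{\ln\frac{R+r}{|R-r|}} .$$ If $\int_{S^k}\omega(x,y)^\alpha\,dS_y=\int_{S^k}\omega(x,y)^\beta\,dS_y$, then $\alpha+\beta=k$ or $\alpha=\beta$.
   Context: For $x\neq y$ in $\mathbb{R}^{k+1}$, $\omega(x,y)=\left|\dfrac{|x|^2-|y|^2}{|x-y|^2}\right|$. $dS_y$ is the surface measure on $S^k$. For $|x|\neq R$ and $y\in S^k$, $\omega(x,y)>0$ and $\omega^\alpha=e^{\alpha\ln\omega}$. *)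

theory Defs
  imports "HOL-Analysis.Analysis"
begin

definition omega :: "'a::euclidean_space \<Rightarrow> 'a \<Rightarrow> real" where
  "omega x y = \<bar>(norm x ^ 2 - norm y ^ 2) / (norm (x - y) ^ 2)\<bar>"

definition omega_pow :: "'a::euclidean_space \<Rightarrow> 'a \<Rightarrow> complex \<Rightarrow> complex" where
  "omega_pow x y \<alpha> = exp (\<alpha> * complex_of_real (ln (omega x y)))"

text \<open>Surface measure on the sphere of radius R centred at 0 in an n-dimensional
  Euclidean space (n = DIM('a)), via the cone construction:
  sigma(A) = (n/R) * lebesgue({t y : 0 \<le> t \<le> 1, y \<in> A}),
  realised as the push-forward of Lebesgue measure on the open ball under the
  radial projection y \<mapsto> (R/|y|) y, scaled by n/R.\<close>
definition sphere_measure :: "real \<Rightarrow> 'a::euclidean_space measure" where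
  "sphere_measure R =
     scale_measure (ennreal (real DIM('a) / R))
       (distr (restrict_space lborel (ball 0 R)) borel (\<lambda>y. (R / norm y) *\<^sub>R y))"

end

theory Submission
  imports Defs
begin

text \<open>
  Let \<open>T\<close> be the involution of the sphere that swaps the two endpoints of every chord through \<open>x\<close>.
  By the power of the point \<open>x\<close> it replaces \<open>\<omega>\<close> by \<open>1 / \<omega>\<close>, and its Jacobian is \<open>\<omega>\<^sup>k\<close>; hence the
  integrals of \<open>\<omega>\<^sup>a\<close> and \<open>\<omega>\<close> to the power \<open>k - a\<close> agree. Averaging both sides of the hypothesis with
  their reflections gives, with \<open>u = ln \<omega>\<close>, \<open>p = (\<alpha> + \<beta> - k) / 2\<close> and \<open>q = (\<alpha> - \<beta>) / 2\<close>, that the integral of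
  \<open>exp (k u / 2) sinh (p u) sinh (q u)\<close> vanishes. As \<open>\<bar>u\<bar> \<le> ln ((R + r) / \<bar>R - r\<bar>)\<close>, the bound on the
  imaginary parts confines \<open>sinh (p u) sinh (q u)\<close>, for \<open>p, q, u \<noteq> 0\<close>, to a fixed open half plane,
  so \<open>p = 0\<close> or \<open>q = 0\<close>.

  Since the surface measure is defined by cones, the change of variables is carried out on the ball,
  with the extension of \<open>T\<close> that is homogeneous of degree one.
\<close>

subsection \<open>Euclidean spaces as Cartesian powers\<close>

text \<open>The change of variables theorem of the library needs the type \<open>real ^ 'n\<close> with a
  well-ordered index type, so an index type of cardinality \<open>DIM('a)\<close> is needed.\<close>

typedef (overloaded) ('a::euclidean_space) dim_index = "{..<DIM('a)}"
  by (auto intro: exI[of _ 0])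

instantiation dim_index :: (euclidean_space) wellorder
begin

definition less_eq_dim_index :: "'a dim_index \<Rightarrow> 'a dim_index \<Rightarrow> bool" where
  "i \<le> j \<longleftrightarrow> Rep_dim_index i \<le> Rep_dim_index j"

definition less_dim_index :: "'a dim_index \<Rightarrow> 'a dim_index \<Rightarrow> bool" where
  "i < j \<longleftrightarrow> Rep_dim_index i < Rep_dim_index j"

instance
proof
  fix P :: "'a dim_index \<Rightarrow> bool" and i
  assume step: "\<And>i. (\<And>j. j < i \<Longrightarrow> P j) \<Longrightarrow> P i"
  show "P i"
    by (induction i rule: measure_induct_rule[of Rep_dim_index])
       (auto intro: step simp: less_dim_index_def)
qed (auto simp: less_eq_dim_index_def less_dim_index_def Rep_dim_index_inject)

end

lemma bij_betw_Rep_dim_index: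
  "bij_betw (Rep_dim_index :: 'a::euclidean_space dim_index \<Rightarrow> nat) UNIV {..<DIM('a)}"
  using type_definition.Rep_range[OF type_definition_dim_index]
  by (auto simp: bij_betw_def inj_on_def Rep_dim_index_inject)

instance dim_index :: (euclidean_space) finite
  by standard (use bij_betw_finite[OF bij_betw_Rep_dim_index] in auto)

lemma CARD_dim_index [simp]: "CARD('a::euclidean_space dim_index) = DIM('a)"
  by (simp add: bij_betw_same_card[OF bij_betw_Rep_dim_index])

text \<open>Serves to move Lebesgue integrals on \<open>'a\<close> to coordinates, and also to treat
  values in a Euclidean space coordinatewise. The coordinate axes are sent to an enumeration of
  \<open>Basis\<close>, so preimages of boxes are boxes with the same side lengths, which determines
  the measure.\<close>

lemma ex_isometry_dim_index:
  obtains \<iota> :: "real ^ ('a::euclidean_space dim_index) \<Rightarrow> 'a"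
  where "linear \<iota>" "bij \<iota>" "\<And>u v. \<iota> u \<bullet> \<iota> v = u \<bullet> v" "distr lborel borel \<iota> = lborel"
proof -
  obtain h where h: "bij_betw h {..<DIM('a)} (Basis :: 'a set)"
    using ex_bij_betw_nat_finite[OF finite_Basis] by (auto simp: atLeast0LessThan)
  define b where "b = h \<circ> (Rep_dim_index :: 'a dim_index \<Rightarrow> nat)"
  have b: "bij_betw b UNIV Basis"
    unfolding b_def by (rule bij_betw_trans[OF bij_betw_Rep_dim_index h])
  have bB [simp]: "b i \<in> Basis" for i
    using b by (auto simp: bij_betw_def)
  have bb: "b i \<bullet> b j = (if i = j then 1 else 0)" for i j
    using b by (auto simp: inner_Basis bij_betw_def inj_on_def)
  define \<iota> where "\<iota> v = (\<Sum>i\<in>UNIV. (v $ i) *\<^sub>R b i)" for v :: "real ^ 'a dim_index"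
  define \<kappa> where "\<kappa> y = (\<chi> i. y \<bullet> b i)" for y :: 'a
  have lin: "linear \<iota>"
    unfolding \<iota>_def by (intro linearI) (simp_all add: scaleR_left_distrib sum.distrib scaleR_sum_right)
  have \<iota>_b: "\<iota> v \<bullet> b i = v $ i" for v i
    by (simp add: \<iota>_def inner_sum_left bb if_distrib cong: if_cong)
  have \<kappa>\<iota>: "\<kappa> (\<iota> v) = v" for v
    by (simp add: \<kappa>_def \<iota>_b vec_eq_iff)
  have \<iota>\<kappa>: "\<iota> (\<kappa> y) = y" for y
  proof -
    have "\<iota> (\<kappa> y) = (\<Sum>c\<in>Basis. (y \<bullet> c) *\<^sub>R c)"
      unfolding \<iota>_def \<kappa>_def
      by (simp add: sum.reindex_bij_betw[OF b, of "\<lambda>c. (y \<bullet> c) *\<^sub>R c"])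
    thus ?thesis by (simp add: euclidean_representation)
  qed
  have bij: "bij \<iota>"
    by (rule bij_betw_byWitness[where f'=\<kappa>]) (auto simp: \<kappa>\<iota> \<iota>\<kappa>)
  have inner: "\<iota> u \<bullet> \<iota> v = u \<bullet> v" for u v
    by (subst (2) \<iota>_def) (simp add: inner_sum_right \<iota>_b inner_vec_def mult.commute)
  have meas: "\<iota> \<in> borel_measurable borel"
    by (intro borel_measurable_continuous_onI linear_continuous_on linear_conv_bounded_linear[THEN iffD1] lin)
  have "lborel = distr lborel borel \<iota>"
  proof (rule lborel_eqI)
    fix l u :: 'a
    assume lu: "\<And>c. c \<in> Basis \<Longrightarrow> l \<bullet> c \<le> u \<bullet> c"
    have vim: "\<iota> -` box l u \<inter> space lborel = box (\<kappa> l) (\<kappa> u)"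
    proof -
      have "(\<forall>c\<in>Basis. l \<bullet> c < \<iota> v \<bullet> c \<and> \<iota> v \<bullet> c < u \<bullet> c)
        \<longleftrightarrow> (\<forall>i. l \<bullet> b i < v $ i \<and> v $ i < u \<bullet> b i)" for v
        using b unfolding bij_betw_def by (metis \<iota>_b bB imageE)
      hence "\<iota> v \<in> box l u \<longleftrightarrow> v \<in> box (\<kappa> l) (\<kappa> u)" for v
        by (subst mem_box, subst mem_box_cart) (simp add: \<kappa>_def)
      thus ?thesis by auto
    qed
    have "emeasure (distr lborel borel \<iota>) (box l u) = emeasure lborel (box (\<kappa> l) (\<kappa> u))"
      using vim meas by (subst emeasure_distr) auto
    also have "\<dots> = ennreal (\<Prod>c\<in>Basis. (\<kappa> u - \<kappa> l) \<bullet> c)"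
      by (subst emeasure_lborel_box) (auto simp: Basis_vec_def inner_axis \<kappa>_def lu)
    also have "(\<Prod>c\<in>Basis. (\<kappa> u - \<kappa> l) \<bullet> c) = (\<Prod>i\<in>UNIV. (\<kappa> u - \<kappa> l) $ i)"
      by (subst prod.reindex_bij_betw[symmetric, of "\<lambda>i. axis i 1" UNIV])
         (auto simp: bij_betw_def inj_on_def axis_eq_axis Basis_vec_def inner_axis)
    also have "\<dots> = (\<Prod>i\<in>UNIV. (u - l) \<bullet> b i)"
      by (simp add: \<kappa>_def inner_diff_left)
    also have "\<dots> = (\<Prod>c\<in>Basis. (u - l) \<bullet> c)"
      by (rule prod.reindex_bij_betw[OF b])
    finally show "emeasure (distr lborel borel \<iota>) (box l u) = ennreal (\<Prod>c\<in>Basis. (u - l) \<bullet> c)"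
      by simp
  qed auto
  with lin bij inner show ?thesis by (intro that) auto
qed

subsection \<open>Reflections and chords through a point\<close>

text \<open>The map fixes \<open>e\<close> and is multiplication by \<open>c\<close> on the
  orthogonal complement. After a rotation taking a coordinate axis to \<open>e\<close> it is
  diagonal, with one entry 1 and all others \<open>c\<close>.\<close>

lemma abs_det_scale_off_line:
  fixes e :: "real ^ 'n"
  assumes e: "norm e = 1"
  shows "\<bar>det (matrix (\<lambda>v. c *\<^sub>R v + ((1 - c) * (e \<bullet> v)) *\<^sub>R e))\<bar> = \<bar>c\<bar> ^ (CARD('n) - 1)"
proof -
  fix k :: 'n
  define M where "M v = c *\<^sub>R v + ((1 - c) * (e \<bullet> v)) *\<^sub>R e" for v
  define D where "D v = c *\<^sub>R v + ((1 - c) * (v $ k)) *\<^sub>R axis k 1" for v :: "real^'n"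
  obtain f :: "real^'n \<Rightarrow> real^'n" where f: "orthogonal_transformation f" "f (axis k 1) = e"
    using orthogonal_transformation_exists[of "axis k 1" e] e by (auto simp: norm_axis_1)
  have lf: "linear f" using f(1) by (simp add: orthogonal_transformation_def)
  have lM: "linear M"
    unfolding M_def by (intro linearI) (simp_all add: inner_add_right algebra_simps)
  have lD: "linear D"
    unfolding D_def by (intro linearI) (simp_all add: algebra_simps)
  have "M \<circ> f = f \<circ> D"
  proof
    fix v
    have "e \<bullet> f v = axis k 1 \<bullet> v"
      using f unfolding orthogonal_transformation_def by metis
    also have "\<dots> = v $ k" by (simp add: inner_axis inner_commute)
    finally show "(M \<circ> f) v = (f \<circ> D) v"
      by (simp add: M_def D_def linear_add[OF lf] linear_scale[OF lf] f(2))
  qed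
  hence "matrix M ** matrix f = matrix f ** matrix D"
    using matrix_compose[OF lf lM] matrix_compose[OF lD lf] by simp
  hence "\<bar>det (matrix M)\<bar> * \<bar>det (matrix f)\<bar> = \<bar>det (matrix f)\<bar> * \<bar>det (matrix D)\<bar>"
    by (metis abs_mult det_mul)
  hence "\<bar>det (matrix M)\<bar> = \<bar>det (matrix D)\<bar>"
    using f(1) by simp
  also have "det (matrix D) = (\<Prod>i\<in>UNIV. matrix D $ i $ i)"
    by (rule det_diagonal) (auto simp: matrix_def D_def axis_def)
  also have "\<dots> = (\<Prod>i\<in>UNIV. if i = k then 1 else c)"
    by (rule prod.cong) (auto simp: matrix_def D_def axis_def)
  also have "\<dots> = c ^ (CARD('n) - 1)"
    by (subst prod.remove[of _ k]) (auto simp: card_Diff_singleton)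
  finally show ?thesis by (simp add: M_def[abs_def] power_abs)
qed

text \<open>For \<open>d = 0\<close> this is the identity, so the norm and involution laws below
  hold for every \<open>d\<close>.\<close>

definition reflect_along :: "'a::real_inner \<Rightarrow> 'a \<Rightarrow> 'a" where
  "reflect_along d v = v - (2 * (d \<bullet> v) / (d \<bullet> d)) *\<^sub>R d"

lemma orthogonal_transformation_reflect_along:
  "d \<noteq> 0 \<Longrightarrow> orthogonal_transformation (reflect_along d)"
  unfolding orthogonal_transformation_def reflect_along_def
  by (auto intro!: linearI simp: inner_add_right algebra_simps add_divide_distrib inner_commute)

lemma reflect_along_scaleR: "c \<noteq> 0 \<Longrightarrow> reflect_along (c *\<^sub>R d) v = reflect_along d v"
  by (simp add: reflect_along_def)

lemma reflect_along_involution: "reflect_along d (reflect_along d v) = v"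
  by (cases "d = 0") (simp_all add: reflect_along_def inner_diff_right)

text \<open>The second intersection of the line through \<open>x\<close> and \<open>u\<close> with
  the sphere through \<open>u\<close> about the origin: by the power of the point \<open>x\<close>,
  the inner product of the vectors from \<open>x\<close> to both ends is
  \<open>x \<bullet> x - u \<bullet> u\<close>.\<close>

definition chord_end :: "'a::real_inner \<Rightarrow> 'a \<Rightarrow> 'a" where
  "chord_end x u = x + ((x \<bullet> x - u \<bullet> u) / ((u - x) \<bullet> (u - x))) *\<^sub>R (u - x)"

text \<open>The two ends of a chord are mirror images in the hyperplane through the centre
  orthogonal to the chord.\<close>

lemma chord_end_eq_reflect:
  assumes "u \<noteq> x"
  shows "chord_end x u = reflect_along (u - x) u"
proof -
  define d where "d = u - x"
  have x: "x = u - d" and d: "d \<bullet> d \<noteq> 0" using assms by (auto simp: d_def)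
  have "x \<bullet> x - u \<bullet> u = d \<bullet> d - 2 * (d \<bullet> u)"
    by (simp add: x inner_diff_left inner_diff_right inner_commute)
  thus ?thesis using d
    unfolding chord_end_def reflect_along_def d_def[symmetric]
    by (simp add: x diff_divide_distrib scaleR_diff_left)
qed

lemma norm_reflect_along: "norm (reflect_along d v) = norm v"
proof (cases "d = 0")
  case False
  thus ?thesis using orthogonal_transformation_reflect_along orthogonal_transformation_norm by blast
qed (simp add: reflect_along_def)

lemma norm_chord_end: "norm (chord_end x u) = norm u" if "u \<noteq> x"
  using that by (simp add: chord_end_eq_reflect norm_reflect_along)

text \<open>Seen from \<open>x\<close>, the new end lies in a direction parallel to the old one, so
  both steps use the same reflection. The assumption makes the factor \<open>c\<close> between the
  two directions nonzero.\<close>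

lemma chord_end_involution:
  assumes "norm x \<noteq> norm u"
  shows "chord_end x (chord_end x u) = u"
proof -
  have ne: "u \<noteq> x" using assms by auto
  define c where "c = (x \<bullet> x - u \<bullet> u) / ((u - x) \<bullet> (u - x))"
  have c: "c \<noteq> 0" using assms ne by (auto simp: c_def dot_square_norm)
  have eq: "chord_end x u - x = c *\<^sub>R (u - x)" by (simp add: chord_end_def c_def)
  have "chord_end x u \<noteq> x" using norm_chord_end[OF ne] assms by auto
  hence "chord_end x (chord_end x u) = reflect_along (c *\<^sub>R (u - x)) (chord_end x u)"
    by (simp add: chord_end_eq_reflect eq)
  also have "\<dots> = u"
    using c ne by (simp add: reflect_along_scaleR chord_end_eq_reflect reflect_along_involution)
  finally show ?thesis .
qed

text \<open>Power of a point: the distances \<open>a\<close> and \<open>b\<close> from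
  \<open>x\<close> to the two ends satisfy \<open>a * b = \<bar>A\<bar>\<close>, so
  \<open>omega\<close> is \<open>a / b\<close> at one end and \<open>b / a\<close> at the
  other.\<close>

lemma omega_chord_end:
  assumes "norm x \<noteq> norm u"
  shows "omega x (chord_end x u) = 1 / omega x u"
proof -
  have ne: "u \<noteq> x" using assms by auto
  define A where "A = norm x ^ 2 - norm u ^ 2"
  define a where "a = norm (x - chord_end x u)"
  define b where "b = norm (x - u)"
  have nz: "b \<noteq> 0" "A \<noteq> 0" using ne assms by (auto simp: A_def b_def)
  have "a = \<bar>A\<bar> / b\<^sup>2 * b"
    by (simp add: a_def b_def A_def chord_end_def dot_square_norm norm_minus_commute)
  hence A: "\<bar>A\<bar> = a * b" using nz by (simp add: power2_eq_square)
  hence "a \<noteq> 0" using nz by auto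
  thus ?thesis using nz
    unfolding omega_def norm_chord_end[OF ne] A_def[symmetric] a_def[symmetric] b_def[symmetric]
    by (simp add: abs_div A power2_eq_square)
qed

section \<open>Derivatives of the chord maps\<close>

text \<open>With \<open>K\<close> constant the map is, up to sign, an inversion about
  \<open>x\<close>, hence conformal: its derivative is a multiple of a reflection. On the sphere of
  radius \<open>R\<close>, \<open>chord_end x\<close> has this form with
  \<open>K = x \<bullet> x - R\<^sup>2\<close>.\<close>

lemma has_derivative_scaled_inversion:
  fixes x u :: "'a::euclidean_space" and K :: real
  assumes "u \<noteq> x"
  shows "((\<lambda>u. x + (K / ((u - x) \<bullet> (u - x))) *\<^sub>R (u - x)) has_derivative
    (\<lambda>w. (K / ((u - x) \<bullet> (u - x))) *\<^sub>R reflect_along (u - x) w)) (at u)"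
proof -
  let ?d = "u - x"
  have d: "?d \<bullet> ?d \<noteq> 0" using assms by simp
  have 1: "((\<lambda>u. K / ((u - x) \<bullet> (u - x))) has_derivative
      (\<lambda>w. - (2 * K * (?d \<bullet> w)) / (?d \<bullet> ?d)\<^sup>2)) (at u)"
    using d by (auto intro!: derivative_eq_intros simp: inner_commute power2_eq_square)
  have 2: "((\<lambda>u. u - x) has_derivative (\<lambda>w. w)) (at u)"
    by (auto intro!: derivative_eq_intros)
  show ?thesis
    by (rule has_derivative_eq_rhs[OF has_derivative_add[OF has_derivative_const has_derivative_scaleR[OF 1 2]]])
      (use d in \<open>auto simp: fun_eq_iff reflect_along_def scaleR_diff_right power2_eq_square divide_simps mult_ac\<close>)
qed

text \<open>The homogeneous extension of degree one of the involution of the sphere of radius \<open>R\<close>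
  that swaps the two endpoints of each chord through \<open>x\<close>.\<close>
definition chord_flip :: "real \<Rightarrow> 'a::real_inner \<Rightarrow> 'a \<Rightarrow> 'a" where
  "chord_flip R x y = (norm y / R) *\<^sub>R chord_end x ((R / norm y) *\<^sub>R y)"

context
  fixes R :: real and x :: "'a::euclidean_space"
  assumes R: "R > 0" and xR: "norm x \<noteq> R"
begin

lemma chord_flip_props:
  assumes y: "y \<noteq> 0"
  shows norm_chord_flip: "norm (chord_flip R x y) = norm y"
    and project_chord_flip:
      "(R / norm (chord_flip R x y)) *\<^sub>R chord_flip R x y = chord_end x ((R / norm y) *\<^sub>R y)"
    and chord_flip_involution: "chord_flip R x (chord_flip R x y) = y"
proof -
  have n: "norm ((R / norm y) *\<^sub>R y) = R" using R y by simp
  hence ne: "(R / norm y) *\<^sub>R y \<noteq> x" using xR by auto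
  show 1: "norm (chord_flip R x y) = norm y"
    using R y n norm_chord_end[OF ne] by (simp add: chord_flip_def)
  show 2: "(R / norm (chord_flip R x y)) *\<^sub>R chord_flip R x y = chord_end x ((R / norm y) *\<^sub>R y)"
    unfolding 1 using R y by (simp add: chord_flip_def)
  show "chord_flip R x (chord_flip R x y) = y"
    unfolding chord_flip_def[of R x "chord_flip R x y"] 2
    using chord_end_involution[of x "(R / norm y) *\<^sub>R y"] n xR 1 R y by simp
qed

lemma has_derivative_radial_projection:
  assumes "y \<noteq> 0"
  shows "((\<lambda>y. (R / norm y) *\<^sub>R y) has_derivative
    (\<lambda>v. (R / norm y) *\<^sub>R (v - ((y \<bullet> v) / (y \<bullet> y)) *\<^sub>R (y::'a)))) (at y)"
proof -
  have 1: "((\<lambda>y. R / norm y) has_derivative (\<lambda>v. - (R * (y \<bullet> v)) / norm y ^ 3)) (at y)"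
    by (rule has_derivative_eq_rhs[OF has_derivative_divide'[OF has_derivative_const has_derivative_norm]])
       (use assms in \<open>auto simp: fun_eq_iff sgn_div_norm inner_commute power3_eq_cube divide_simps\<close>)
  show ?thesis
    by (rule has_derivative_eq_rhs[OF has_derivative_scaleR[OF 1 has_derivative_ident]])
       (use assms in \<open>auto simp: fun_eq_iff dot_square_norm scaleR_diff_right power3_eq_cube power2_eq_square divide_simps\<close>)
qed

text \<open>Homogeneity of degree one gives the radial direction \<open>e\<close> the factor 1. In
  tangential directions the factors \<open>R / norm y\<close> and \<open>norm y / R\<close> cancel,
  leaving the conformal factor \<open>c\<close> of the inversion. Both parts are then reflected
  along \<open>u - x\<close>.\<close>

lemma has_derivative_chord_flip:
  assumes y: "y \<noteq> 0"
  defines "u \<equiv> (R / norm y) *\<^sub>R y"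
  defines "c \<equiv> (x \<bullet> x - R\<^sup>2) / ((u - x) \<bullet> (u - x))"
  defines "e \<equiv> (1 / norm y) *\<^sub>R y"
  shows "(chord_flip R x has_derivative
    (\<lambda>v. reflect_along (u - x) (c *\<^sub>R v + ((1 - c) * (e \<bullet> v)) *\<^sub>R e))) (at y)"
proof -
  have n: "norm u = R" using R y by (simp add: u_def)
  hence ne: "u \<noteq> x" using xR by auto
  \<comment> \<open>Only points of norm \<open>R\<close> are inserted, so the numerator of
    \<open>chord_end\<close> can be frozen at a constant; this makes the derivative of the inversion
    applicable.\<close>
  let ?T = "\<lambda>u. x + ((x \<bullet> x - R\<^sup>2) / ((u - x) \<bullet> (u - x))) *\<^sub>R (u - x)"
  have T: "chord_end x w = ?T w" if "norm w = R" for w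
    using that by (simp add: chord_end_def dot_square_norm)
  have Tu: "?T u = reflect_along (u - x) u"
    using T[OF n] chord_end_eq_reflect[OF ne] by simp
  let ?P = "\<lambda>v. (R / norm y) *\<^sub>R (v - ((y \<bullet> v) / (y \<bullet> y)) *\<^sub>R y)"
  have "((\<lambda>y. (norm y / R) *\<^sub>R ?T ((R / norm y) *\<^sub>R y)) has_derivative
     (\<lambda>v. (norm y / R) *\<^sub>R (c *\<^sub>R reflect_along (u - x) (?P v)) + ((v \<bullet> sgn y) / R) *\<^sub>R ?T u)) (at y)"
  proof -
    have 1: "((\<lambda>y. norm y / R) has_derivative (\<lambda>v. (v \<bullet> sgn y) / R)) (at y)"
      using R by (auto intro!: derivative_eq_intros has_derivative_norm y)
    have 2: "((\<lambda>y. ?T ((R / norm y) *\<^sub>R y)) has_derivative (\<lambda>v. c *\<^sub>R reflect_along (u - x) (?P v))) (at y)"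
      using has_derivative_compose[OF has_derivative_radial_projection[OF y]
          has_derivative_scaled_inversion[OF ne, unfolded u_def]]
      unfolding u_def c_def by simp
    show ?thesis
      using has_derivative_scaleR[OF 1 2] by (simp only: u_def)
  qed
  moreover have "(norm y / R) *\<^sub>R (c *\<^sub>R reflect_along (u - x) (?P v)) + ((v \<bullet> sgn y) / R) *\<^sub>R ?T u
     = reflect_along (u - x) (c *\<^sub>R v + ((1 - c) * (e \<bullet> v)) *\<^sub>R e)" for v
  proof -
    have lin: "linear (reflect_along (u - x))"
      using ne orthogonal_transformation_reflect_along[of "u - x"]
      by (simp add: orthogonal_transformation_def)
    have "(norm y / R) *\<^sub>R (c *\<^sub>R reflect_along (u - x) (?P v)) + ((v \<bullet> sgn y) / R) *\<^sub>R ?T u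
      = reflect_along (u - x) ((norm y / R * c) *\<^sub>R ?P v + ((v \<bullet> sgn y) / R) *\<^sub>R u)"
      unfolding Tu by (simp add: linear_add[OF lin] linear_scale[OF lin])
    also have "(norm y / R * c) *\<^sub>R ?P v + ((v \<bullet> sgn y) / R) *\<^sub>R u
      = c *\<^sub>R v + ((1 - c) * (e \<bullet> v)) *\<^sub>R e"
    proof -
      have "((y \<bullet> v) / (y \<bullet> y)) *\<^sub>R y = (e \<bullet> v) *\<^sub>R e"
        by (simp add: e_def dot_square_norm power2_eq_square)
      moreover have "v \<bullet> sgn y = e \<bullet> v" "u = R *\<^sub>R e"
        by (simp_all add: e_def u_def sgn_div_norm inner_commute divide_inverse)
      ultimately show ?thesis using R y by (simp add: algebra_simps)
    qed
    finally show ?thesis .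
  qed
  ultimately have "((\<lambda>y. (norm y / R) *\<^sub>R ?T ((R / norm y) *\<^sub>R y)) has_derivative
     (\<lambda>v. reflect_along (u - x) (c *\<^sub>R v + ((1 - c) * (e \<bullet> v)) *\<^sub>R e))) (at y)"
    by simp
  thus ?thesis
  proof (rule has_derivative_transform_within_open[of _ _ _ _ "- {0}"])
    fix z :: 'a assume "z \<in> - {0}"
    hence "norm ((R / norm z) *\<^sub>R z) = R" using R by simp
    from T[OF this] show "(norm z / R) *\<^sub>R ?T ((R / norm z) *\<^sub>R z) = chord_flip R x z"
      by (simp add: chord_flip_def)
  qed (use y in auto)
qed

end

subsection \<open>A sign condition for products of hyperbolic sines\<close>

text \<open>Since \<open>sinh\<close> is odd, it suffices to treat nonnegative real parts of
  \<open>p\<close>, \<open>q\<close> and positive \<open>u\<close>. There the real or the imaginary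
  part of the product keeps a strict sign, so \<open>\<epsilon>\<close> can be chosen among 1, -1, i
  and -i.\<close>

lemma sinh_product_one_signed:
  fixes p q :: complex and L :: real
  assumes p: "p \<noteq> 0" and q: "q \<noteq> 0" and b: "(\<bar>Im p\<bar> + \<bar>Im q\<bar>) * L \<le> pi / 2"
  obtains \<epsilon> :: complex where
    "\<And>u::real. 0 < \<bar>u\<bar> \<Longrightarrow> \<bar>u\<bar> \<le> L \<Longrightarrow> Re (\<epsilon> * (sinh (p * u) * sinh (q * u))) > 0"
proof -
  have *: "\<exists>\<epsilon>. \<forall>u::real. 0 < u \<and> u \<le> L \<longrightarrow> Re (\<epsilon> * (sinh (p * u) * sinh (q * u))) > 0"
    if p: "p \<noteq> 0" "Re p \<ge> 0" and q: "q \<noteq> 0" "Re q \<ge> 0"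
      and b: "(\<bar>Im p\<bar> + \<bar>Im q\<bar>) * L \<le> pi / 2" for p q :: complex
  proof -
    have Re_sinh: "Re (sinh z) = sinh (Re z) * cos (Im z)"
      and Im_sinh: "Im (sinh z) = cosh (Re z) * sin (Im z)" for z :: complex
      by (simp_all add: sinh_def cosh_def Re_exp Im_exp field_simps)
    have Re_eq: "Re (sinh (p * u) * sinh (q * u)) =
        sinh (Re p * u) * cos (Im p * u) * (sinh (Re q * u) * cos (Im q * u))
        - cosh (Re p * u) * sin (Im p * u) * (cosh (Re q * u) * sin (Im q * u))"
      and Im_eq: "Im (sinh (p * u) * sinh (q * u)) =
        sinh (Re p * u) * cos (Im p * u) * (cosh (Re q * u) * sin (Im q * u))
        + cosh (Re p * u) * sin (Im p * u) * (sinh (Re q * u) * cos (Im q * u))" for u :: real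
      by (simp_all add: Re_sinh Im_sinh)
    \<comment> \<open>Cosines need an angle strictly below \<open>pi / 2\<close>, which holds when
      the other imaginary part is nonzero. If it is zero, the angle may reach \<open>pi / 2\<close>;
      then only its sine is used, for which \<open>bound2\<close> suffices.\<close>
    have bound: "\<bar>t * u\<bar> < pi / 2" if "0 < u" "u \<le> L" "\<bar>t\<bar> < \<bar>Im p\<bar> + \<bar>Im q\<bar>" for t u :: real
    proof -
      have "\<bar>t * u\<bar> < (\<bar>Im p\<bar> + \<bar>Im q\<bar>) * u" using that by (simp add: abs_mult)
      also have "\<dots> \<le> (\<bar>Im p\<bar> + \<bar>Im q\<bar>) * L" using that by (intro mult_left_mono) auto
      finally show ?thesis using b by simp
    qed
    have bound2: "\<bar>t * u\<bar> < pi" if "0 < u" "u \<le> L" "\<bar>t\<bar> \<le> \<bar>Im p\<bar> + \<bar>Im q\<bar>" for t u :: real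
    proof -
      have "\<bar>t * u\<bar> \<le> (\<bar>Im p\<bar> + \<bar>Im q\<bar>) * u" using that by (simp add: abs_mult)
      also have "\<dots> \<le> (\<bar>Im p\<bar> + \<bar>Im q\<bar>) * L" using that by (intro mult_left_mono) auto
      finally show ?thesis using b pi_gt_zero by linarith
    qed
    have cos_pos: "cos (t * u) > 0" if "0 < u" "u \<le> L" "\<bar>t\<bar> < \<bar>Im p\<bar> + \<bar>Im q\<bar>" for t u :: real
      using bound[OF that] by (intro cos_gt_zero_pi) auto
    have sin_sgn: "sgn t * sin (t * u) > 0" if "0 < u" "u \<le> L" "\<bar>t\<bar> \<le> \<bar>Im p\<bar> + \<bar>Im q\<bar>" "t \<noteq> 0" for t u :: real
    proof (cases "t > 0")
      case True
      thus ?thesis using bound2[OF that(1-3)] that(1) by (simp add: sin_gt_zero)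
    next
      case False
      hence "sin (- t * u) > 0" using bound2[OF that(1-3)] that(1,4)
        by (intro sin_gt_zero) (auto simp: mult_neg_pos)
      thus ?thesis using False that(4) by simp
    qed
    have sinh_pos: "sinh (a * u) > 0" if "0 < u" "a > 0" for a u :: real
      using that by simp
    have sinh_nn: "sinh (a * u) \<ge> 0" if "0 < u" "a \<ge> 0" for a u :: real
      using that by simp
    \<comment> \<open>The real part is positive in \<open>b0\<close> and \<open>opp\<close> and
      negative in \<open>re0\<close>. In the other cases the imaginary part has the sign of a
      nonzero \<open>Im p\<close> or \<open>Im q\<close>; multiplying by \<open>- \<i>\<close> times
      that sign turns it into a positive real part.\<close>
    consider (b0) "Im p = 0" "Im q = 0" | (b1) "Im p = 0" "Im q \<noteq> 0" | (b2) "Im p \<noteq> 0" "Im q = 0"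
      | (opp) "Im p \<noteq> 0" "Im q \<noteq> 0" "sgn (Im p) * sgn (Im q) = -1"
      | (re0) "Im p \<noteq> 0" "Im q \<noteq> 0" "Re p = 0" "Re q = 0" "sgn (Im p) = sgn (Im q)"
      | (same) "Im p \<noteq> 0" "Im q \<noteq> 0" "Re p > 0 \<or> Re q > 0" "sgn (Im p) = sgn (Im q)"
    proof -
      have "sgn (Im p) = sgn (Im q) \<or> sgn (Im p) * sgn (Im q) = -1 \<or> Im p = 0 \<or> Im q = 0"
        by (simp add: sgn_if)
      moreover have "Re p > 0 \<or> Re p = 0" "Re q > 0 \<or> Re q = 0" using p(2) q(2) by auto
      ultimately show ?thesis using that by blast
    qed
    thus ?thesis
    proof cases
      case b0
      hence "Re p > 0" "Re q > 0" using p q by (auto simp: complex_eq_iff)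
      thus ?thesis using b0
        by (intro exI[of _ 1] allI impI) (auto simp add: Re_eq simp del: times_complex.sel)
    next
      case b1
      hence "Re p > 0" using p by (auto simp: complex_eq_iff)
      show ?thesis
      proof (intro exI[of _ "- \<i> * sgn (Im q)"] allI impI)
        fix u assume u: "0 < u \<and> u \<le> L"
        have "0 < sinh (Re p * u) * (cosh (Re q * u) * (sgn (Im q) * sin (Im q * u)))"
          using u \<open>Re p > 0\<close> b1 by (intro mult_pos_pos sin_sgn) auto
        thus "Re (- \<i> * sgn (Im q) * (sinh (p * u) * sinh (q * u))) > 0"
          using b1 Im_eq[of u] by (simp add: algebra_simps)
      qed
    next
      case b2
      hence "Re q > 0" using q by (auto simp: complex_eq_iff)
      show ?thesis
      proof (intro exI[of _ "- \<i> * sgn (Im p)"] allI impI)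
        fix u assume u: "0 < u \<and> u \<le> L"
        have "0 < sinh (Re q * u) * (cosh (Re p * u) * (sgn (Im p) * sin (Im p * u)))"
          using u \<open>Re q > 0\<close> b2 by (intro mult_pos_pos sin_sgn) auto
        thus "Re (- \<i> * sgn (Im p) * (sinh (p * u) * sinh (q * u))) > 0"
          using b2 Im_eq[of u] by (simp add: algebra_simps)
      qed
    next
      case opp
      show ?thesis
      proof (intro exI[of _ 1] allI impI)
        fix u assume u: "0 < u \<and> u \<le> L"
        have "0 \<le> sinh (Re p * u) * cos (Im p * u) * (sinh (Re q * u) * cos (Im q * u))"
          using u p q opp cos_pos[of u] by (intro mult_nonneg_nonneg sinh_nn less_imp_le[OF cos_pos]) auto
        moreover have "0 < (cosh (Re p * u) * (sgn (Im p) * sin (Im p * u))) * (cosh (Re q * u) * (sgn (Im q) * sin (Im q * u)))"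
          using u opp by (intro mult_pos_pos sin_sgn) auto
        hence "0 < (sgn (Im p) * sgn (Im q)) * (cosh (Re p * u) * sin (Im p * u) * (cosh (Re q * u) * sin (Im q * u)))"
          by (simp only: mult_ac)
        ultimately show "Re (1 * (sinh (p * u) * sinh (q * u))) > 0"
          unfolding opp mult_1_left Re_eq by linarith
      qed
    next
      case re0
      show ?thesis
      proof (intro exI[of _ "-1"] allI impI)
        fix u assume u: "0 < u \<and> u \<le> L"
        have "0 < (sgn (Im p) * sin (Im p * u)) * (sgn (Im q) * sin (Im q * u))"
          using u re0 by (intro mult_pos_pos sin_sgn) auto
        also have "\<dots> = (sgn (Im p) * sgn (Im q)) * (sin (Im p * u) * sin (Im q * u))"
          by (simp only: mult_ac)
        also have "sgn (Im p) * sgn (Im q) = 1"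
          using re0 by (simp add: sgn_if split: if_splits)
        finally show "Re (-1 * (sinh (p * u) * sinh (q * u))) > 0"
          using re0 Re_eq[of u] by (simp del: times_complex.sel)
      qed
    next
      case same
      show ?thesis
      proof (intro exI[of _ "- \<i> * sgn (Im p)"] allI impI)
        fix u assume u: "0 < u \<and> u \<le> L"
        have cp: "cos (Im p * u) > 0" "cos (Im q * u) > 0"
          using u same by (auto intro!: cos_pos)
        have s: "cosh (Re q * u) * (sgn (Im p) * sin (Im q * u)) > 0"
           "cosh (Re p * u) * (sgn (Im p) * sin (Im p * u)) > 0"
          using u same sin_sgn[of u "Im q"] sin_sgn[of u "Im p"] by (auto intro!: mult_pos_pos)
        have "0 < sinh (Re p * u) * cos (Im p * u) * (cosh (Re q * u) * (sgn (Im p) * sin (Im q * u)))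
          + cosh (Re p * u) * (sgn (Im p) * sin (Im p * u)) * (sinh (Re q * u) * cos (Im q * u))"
          using same(3)
        proof
          assume "Re p > 0"
          thus ?thesis
            using u q(2) add_pos_nonneg[OF mult_pos_pos[OF mult_pos_pos[OF sinh_pos cp(1)] s(1)]
              mult_nonneg_nonneg[OF less_imp_le[OF s(2)] mult_nonneg_nonneg[OF sinh_nn less_imp_le[OF cp(2)]]]]
            by blast
        next
          assume "Re q > 0"
          thus ?thesis
            using u p(2) add_nonneg_pos[OF mult_nonneg_nonneg[OF mult_nonneg_nonneg[OF sinh_nn less_imp_le[OF cp(1)]]
              less_imp_le[OF s(1)]] mult_pos_pos[OF s(2) mult_pos_pos[OF sinh_pos cp(2)]]]
            by blast
        qed
        thus "Re (- \<i> * sgn (Im p) * (sinh (p * u) * sinh (q * u))) > 0"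
          using Im_eq[of u] by (simp add: algebra_simps)
      qed
    qed
  qed
  define P where "P = (if Re p \<ge> 0 then p else - p)"
  define Q where "Q = (if Re q \<ge> 0 then q else - q)"
  have "P \<noteq> 0" "Re P \<ge> 0" "Q \<noteq> 0" "Re Q \<ge> 0" "(\<bar>Im P\<bar> + \<bar>Im Q\<bar>) * L \<le> pi / 2"
    using p q b by (auto simp: P_def Q_def)
  then obtain \<epsilon> where \<epsilon>: "\<And>u::real. 0 < u \<Longrightarrow> u \<le> L \<Longrightarrow> Re (\<epsilon> * (sinh (P * u) * sinh (Q * u))) > 0"
    using *[of P Q] by blast
  \<comment> \<open>Negating exactly one of \<open>p\<close> and \<open>q\<close> flips the sign of
    the product. Negating \<open>u\<close> changes both factors and so leaves the product
    unchanged.\<close>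
  define \<delta> where "\<delta> = (if (Re p \<ge> 0) = (Re q \<ge> 0) then \<epsilon> else - \<epsilon>)"
  have eq: "\<epsilon> * (sinh (P * u) * sinh (Q * u)) = \<delta> * (sinh (p * u) * sinh (q * u))" for u :: real
    by (auto simp: P_def Q_def \<delta>_def)
  have "Re (\<delta> * (sinh (p * u) * sinh (q * u))) > 0" if "0 < \<bar>u\<bar>" "\<bar>u\<bar> \<le> L" for u :: real
  proof (cases "u > 0")
    case True
    thus ?thesis using \<epsilon>[of u] that unfolding eq by simp
  next
    case False
    thus ?thesis using \<epsilon>[of "-u"] that unfolding eq by simp
  qed
  thus ?thesis by (rule that)
qed

subsection \<open>Change of variables\<close>

text \<open>The integral commutes with bounded linear maps, so values are carried to coordinates by
  \<open>j\<close> and back by \<open>\<iota>\<close>. This allows complex integrands.\<close>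

lemma integral_change_of_variables_euclidean:
  fixes f :: "real ^ 'm::{finite,wellorder} \<Rightarrow> 'b::euclidean_space"
    and g :: "real ^ 'm::_ \<Rightarrow> real ^ 'm::_"
  assumes S: "S \<in> sets lebesgue"
    and der: "\<And>x. x \<in> S \<Longrightarrow> (g has_derivative g' x) (at x within S)"
    and inj: "inj_on g S"
    and f: "f absolutely_integrable_on (g ` S)"
  shows "integral (g ` S) f = integral S (\<lambda>x. \<bar>det (matrix (g' x))\<bar> *\<^sub>R f (g x))"
proof -
  obtain \<iota> :: "real ^ 'b dim_index \<Rightarrow> 'b" where \<iota>: "linear \<iota>" "surj \<iota>"
    using ex_isometry_dim_index bij_is_surj by metis
  obtain j where "linear j" and \<iota>j: "\<iota> \<circ> j = id"
    using linear_surjective_right_inverse[OF \<iota>] by blast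
  hence bl: "bounded_linear j" "bounded_linear \<iota>"
    using \<iota>(1) by (simp_all add: linear_conv_bounded_linear)
  have j: "\<iota> (j z) = z" for z
    using \<iota>j by (simp add: fun_eq_iff)
  have 1: "(j \<circ> f) absolutely_integrable_on (g ` S)"
    by (rule absolutely_integrable_linear[OF f bl(1)])
  hence 2: "(\<lambda>x. \<bar>det (matrix (g' x))\<bar> *\<^sub>R (j \<circ> f) (g x)) absolutely_integrable_on S"
    using absolutely_integrable_change_of_variables[OF S der inj] by blast
  have "integral (g ` S) f = integral (g ` S) (\<iota> \<circ> (j \<circ> f))"
    by (simp add: o_def j)
  also have "\<dots> = \<iota> (integral (g ` S) (j \<circ> f))"
    by (rule integral_linear[OF set_lebesgue_integral_eq_integral(1)[OF 1] bl(2)])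
  also have "integral (g ` S) (j \<circ> f) = integral S (\<lambda>x. \<bar>det (matrix (g' x))\<bar> *\<^sub>R (j \<circ> f) (g x))"
    using integral_change_of_variables[OF S der inj] 1 by blast
  also have "\<iota> \<dots> = integral S (\<iota> \<circ> (\<lambda>x. \<bar>det (matrix (g' x))\<bar> *\<^sub>R (j \<circ> f) (g x)))"
    by (rule integral_linear[OF set_lebesgue_integral_eq_integral(1)[OF 2] bl(2), symmetric])
  also have "\<dots> = integral S (\<lambda>x. \<bar>det (matrix (g' x))\<bar> *\<^sub>R f (g x))"
    by (simp add: o_def linear_scale[OF \<iota>(1)] j)
  finally show ?thesis .
qed

section \<open>Powers of omega as functions on the ball\<close>

text \<open>Extension from the sphere that is constant along rays: since
  \<open>sphere_measure\<close> is a push-forward under the radial projection, integrands on the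
  sphere appear on the ball in this form.\<close>

definition radial_omega :: "real \<Rightarrow> 'a::euclidean_space \<Rightarrow> 'a \<Rightarrow> real" where
  "radial_omega R x y = omega x ((R / norm y) *\<^sub>R y)"

definition radial_pow :: "real \<Rightarrow> 'a::euclidean_space \<Rightarrow> complex \<Rightarrow> 'a \<Rightarrow> complex" where
  "radial_pow R x a y = omega_pow x ((R / norm y) *\<^sub>R y) a"

lemma radial_pow_eq: "radial_pow R x a y = exp (a * of_real (ln (radial_omega R x y)))"
  by (simp add: radial_pow_def radial_omega_def omega_pow_def)

lemma borel_measurable_omega_pow [measurable]: "(\<lambda>y. omega_pow x y a) \<in> borel_measurable borel"
  unfolding omega_pow_def omega_def by measurable

context
  fixes R :: real and x :: "'a::euclidean_space"
  assumes R: "R > 0" and xR: "norm x \<noteq> R"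
begin

lemma radial_omega_pos:
  assumes "y \<noteq> 0"
  shows "radial_omega R x y > 0"
proof -
  have n: "norm ((R / norm y) *\<^sub>R y) = R" using R assms by simp
  moreover from this have "x \<noteq> (R / norm y) *\<^sub>R y" using xR by auto
  moreover have "(norm x)\<^sup>2 \<noteq> R\<^sup>2" using xR R by simp
  ultimately show ?thesis unfolding radial_omega_def omega_def n by simp
qed

text \<open>The distance \<open>d\<close> from \<open>x\<close> to a point of the sphere lies
  between \<open>B\<close> and \<open>A\<close>, and \<open>omega\<close> equals
  \<open>A * B / d\<^sup>2\<close>, hence lies between \<open>B / A\<close> and
  \<open>A / B\<close>.\<close>

lemma abs_ln_radial_omega_le:
  assumes "y \<noteq> 0"
  shows "\<bar>ln (radial_omega R x y)\<bar> \<le> ln ((R + norm x) / \<bar>R - norm x\<bar>)"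
proof -
  define u where "u = (R / norm y) *\<^sub>R y"
  define A where "A = R + norm x"
  define B where "B = \<bar>R - norm x\<bar>"
  define d where "d = norm (x - u)"
  have n: "norm u = R" using R assms by (simp add: u_def)
  have A: "A > 0" and B: "B > 0" using R xR by (auto simp: A_def B_def add_pos_nonneg)
  have d: "B \<le> d" "d \<le> A"
    using norm_triangle_ineq4[of x u] norm_triangle_ineq3[of x u] n
    by (auto simp: A_def B_def d_def)
  have "(norm x)\<^sup>2 - R\<^sup>2 = (R + norm x) * (norm x - R)"
    by (simp add: power2_eq_square algebra_simps)
  hence "\<bar>(norm x)\<^sup>2 - R\<^sup>2\<bar> = A * B"
    using A by (simp add: A_def B_def abs_mult abs_minus_commute)
  hence W: "radial_omega R x y = A * B / d\<^sup>2"
    unfolding radial_omega_def omega_def u_def[symmetric] n d_def by (simp add: abs_div)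
  have "d > 0" using d B by linarith
  have "ln (radial_omega R x y) = ln A + ln B - 2 * ln d"
    unfolding W using A B \<open>d > 0\<close> by (simp add: ln_div ln_mult ln_realpow)
  moreover have "ln B \<le> ln d" "ln d \<le> ln A" using A B d \<open>d > 0\<close> by simp_all
  ultimately show ?thesis using A B by (simp add: A_def[symmetric] B_def[symmetric] ln_div)
qed

lemma radial_omega_chord_flip:
  assumes "y \<noteq> 0"
  shows "radial_omega R x (chord_flip R x y) = 1 / radial_omega R x y"
  unfolding radial_omega_def project_chord_flip[OF R xR assms]
  by (rule omega_chord_end) (use R xR assms in auto)

lemma continuous_on_radial_omega: "continuous_on (- {0}) (radial_omega R x)"
proof -
  have ne: "norm (x - (R / norm y) *\<^sub>R y) \<noteq> 0" if "y \<noteq> 0" for y :: 'a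
  proof -
    have "norm ((R / norm y) *\<^sub>R y) = R" using that R by simp
    thus ?thesis using xR by auto
  qed
  have u: "continuous_on (- {0}) (\<lambda>y::'a. (R / norm y) *\<^sub>R y)"
    by (intro continuous_on_scaleR continuous_on_divide continuous_on_norm
        continuous_on_const continuous_on_id) auto
  show ?thesis unfolding radial_omega_def[abs_def] omega_def
    by (intro continuous_on_rabs continuous_on_divide continuous_on_diff continuous_on_power
        continuous_on_norm continuous_on_const u) (use ne in auto)
qed

lemma radial_pow_set_integrable: "set_integrable lborel (ball 0 R - {0}) (radial_pow R x a)"
  unfolding set_integrable_def
proof (rule integrableI_bounded_set_indicator)
  show "radial_pow R x a \<in> borel_measurable lborel"
    unfolding radial_pow_def[abs_def] by measurable
  show "emeasure lborel (ball (0::'a) R - {0}) < \<infinity>"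
    by (rule le_less_trans[OF emeasure_mono emeasure_bounded_finite[OF bounded_ball[of 0 R]]]) auto
  show "AE y in lborel. y \<in> ball 0 R - {0} \<longrightarrow>
      norm (radial_pow R x a y) \<le> exp (\<bar>Re a\<bar> * ln ((R + norm x) / \<bar>R - norm x\<bar>))"
  proof (intro AE_I2 impI)
    fix y :: 'a assume "y \<in> ball 0 R - {0}"
    hence "\<bar>Re a * ln (radial_omega R x y)\<bar> \<le> \<bar>Re a\<bar> * ln ((R + norm x) / \<bar>R - norm x\<bar>)"
      unfolding abs_mult by (intro mult_left_mono abs_ln_radial_omega_le) auto
    thus "norm (radial_pow R x a y) \<le> exp (\<bar>Re a\<bar> * ln ((R + norm x) / \<bar>R - norm x\<bar>))"
      by (simp add: radial_pow_eq)
  qed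
qed auto

lemma chord_flip_image: "chord_flip R x ` (ball 0 R - {0}) = ball 0 R - {0}"
proof -
  have "chord_flip R x y \<in> ball 0 R - {0}" if "y \<in> ball 0 R - {0}" for y
  proof -
    have "norm (chord_flip R x y) = norm y" "norm y < R" "norm y \<noteq> 0"
      using that by (auto intro: norm_chord_flip[OF R xR])
    moreover from this have "chord_flip R x y \<noteq> 0" by (metis norm_zero)
    ultimately show ?thesis by simp
  qed
  moreover have "chord_flip R x (chord_flip R x y) = y" if "y \<in> ball 0 R - {0}" for y
    by (rule chord_flip_involution[OF R xR]) (use that in simp)
  ultimately show ?thesis
    by (intro equalityI image_subsetI subsetI) (metis image_eqI)+
qed

end

section \<open>Symmetry of the integrals under reflection of the exponent\<close>

text \<open>Substitution of \<open>chord_flip\<close>, which maps the punctured ball onto itself: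
  with \<open>w\<close> the value of \<open>radial_omega\<close>, it replaces \<open>w\<close> by
  \<open>1 / w\<close> and has Jacobian \<open>w ^ k\<close>, and \<open>w\<close> to the power
  \<open>k - (k - a)\<close> is \<open>w\<close> to the power \<open>a\<close>.\<close>

lemma integral_radial_pow_reflect_cart:
  fixes x :: "real ^ 'm::{finite,wellorder}"
  assumes R: "R > 0" and xR: "norm x \<noteq> R"
  shows "(LINT y:ball 0 R - {0}|lborel. radial_pow R x (of_nat (CARD('m) - 1) - a) y)
    = (LINT y:ball 0 R - {0}|lborel. radial_pow R x a y)"
proof -
  let ?S = "ball 0 R - {0 :: real ^ 'm::_}" and ?k = "CARD('m) - 1"
  let ?b = "of_nat ?k - a"
  define u where "u y = (R / norm y) *\<^sub>R y" for y :: "real ^ 'm::_"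
  define c where "c y = (x \<bullet> x - R\<^sup>2) / ((u y - x) \<bullet> (u y - x))" for y
  define g' where "g' y v = reflect_along (u y - x)
    (c y *\<^sub>R v + ((1 - c y) * (((1 / norm y) *\<^sub>R y) \<bullet> v)) *\<^sub>R ((1 / norm y) *\<^sub>R y))" for y v
  have der: "(chord_flip R x has_derivative g' y) (at y within ?S)" if "y \<in> ?S" for y
    using has_derivative_chord_flip[OF R xR, of y] that
    unfolding g'_def[abs_def] c_def u_def by (auto intro: has_derivative_at_withinI)
  have inj: "inj_on (chord_flip R x) ?S"
    by (rule inj_on_inverseI[of _ "chord_flip R x"]) (use chord_flip_involution[OF R xR] in auto)
  have S: "?S \<in> sets lebesgue" by auto
  have abs_int: "radial_pow R x ?b absolutely_integrable_on ?S"
    using radial_pow_set_integrable[OF R xR, of ?b] unfolding set_integrable_def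
    by (subst integrable_completion) (auto dest: borel_measurable_integrable)
  \<comment> \<open>The reflection contributes a sign only; the other factor scales by
    \<open>c y\<close> off a line, and \<open>\<bar>c y\<bar>\<close> is exactly
    \<open>omega\<close> at the projected point.\<close>
  have det: "\<bar>det (matrix (g' y))\<bar> = radial_omega R x y ^ ?k" if "y \<in> ?S" for y
  proof -
    let ?M = "\<lambda>v. c y *\<^sub>R v + ((1 - c y) * (((1 / norm y) *\<^sub>R y) \<bullet> v)) *\<^sub>R ((1 / norm y) *\<^sub>R y)"
    have n: "norm (u y) = R" using R that by (simp add: u_def)
    hence "u y - x \<noteq> 0" using xR by auto
    hence refl: "orthogonal_transformation (reflect_along (u y - x))"
      by (rule orthogonal_transformation_reflect_along)
    have lM: "linear ?M"
      by (intro linearI) (simp_all add: inner_add_right algebra_simps)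
    have "g' y = reflect_along (u y - x) \<circ> ?M" by (simp add: g'_def fun_eq_iff)
    moreover have "linear (reflect_along (u y - x))"
      using refl by (simp add: orthogonal_transformation_def)
    ultimately have "matrix (g' y) = matrix (reflect_along (u y - x)) ** matrix ?M"
      by (simp only: matrix_compose[OF lM])
    hence "\<bar>det (matrix (g' y))\<bar> = \<bar>det (matrix ?M)\<bar>"
      using orthogonal_transformation_det[OF refl] by (simp add: det_mul abs_mult)
    also have "\<dots> = \<bar>c y\<bar> ^ ?k"
      by (rule abs_det_scale_off_line) (use that in simp)
    also have "\<bar>c y\<bar> = radial_omega R x y"
      unfolding radial_omega_def omega_def c_def u_def[symmetric] n
      by (simp add: dot_square_norm norm_minus_commute)
    finally show ?thesis .
  qed
  have "integral ?S (radial_pow R x ?b) =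
      integral ?S (\<lambda>y. \<bar>det (matrix (g' y))\<bar> *\<^sub>R radial_pow R x ?b (chord_flip R x y))"
    using integral_change_of_variables_euclidean[OF S der inj, of "radial_pow R x ?b"] abs_int
    by (simp only: chord_flip_image[OF R xR])
  also have "\<dots> = integral ?S (radial_pow R x a)"
  proof (rule Henstock_Kurzweil_Integration.integral_cong)
    fix y assume y: "y \<in> ?S"
    define w where "w = radial_omega R x y"
    have w: "w > 0" using radial_omega_pos[OF R xR, of y] y by (simp add: w_def)
    have "\<bar>det (matrix (g' y))\<bar> *\<^sub>R radial_pow R x ?b (chord_flip R x y)
       = of_real (w ^ ?k) * exp (?b * of_real (ln (1 / w)))"
      using y unfolding radial_pow_eq det[OF y] w_def
      by (subst radial_omega_chord_flip[OF R xR]) (auto simp: scaleR_conv_of_real)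
    also have "w ^ ?k = exp (of_nat ?k * ln w)" using w unfolding exp_of_nat_mult by simp
    also have "of_real (exp (of_nat ?k * ln w)) = (exp (of_nat ?k * of_real (ln w)) :: complex)"
      by (simp add: exp_of_real[symmetric])
    also have "\<dots> * exp (?b * of_real (ln (1 / w))) = exp (a * of_real (ln w))"
      using w by (simp add: exp_add[symmetric] ln_div algebra_simps)
    finally show "\<bar>det (matrix (g' y))\<bar> *\<^sub>R radial_pow R x ?b (chord_flip R x y) = radial_pow R x a y"
      by (simp add: radial_pow_eq w_def)
  qed
  finally show ?thesis
    by (simp only: set_borel_integral_eq_integral(2)[OF radial_pow_set_integrable[OF R xR]])
qed

text \<open>Transport along the isometry \<open>\<iota>\<close>: \<open>omega\<close> depends on
  norms only, so the integrand for \<open>x\<close> pulls back to the one for its coordinate vector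
  \<open>z\<close>.\<close>

lemma integral_radial_pow_reflect:
  fixes x :: "'a::euclidean_space"
  assumes R: "R > 0" and xR: "norm x \<noteq> R"
  shows "(LINT y:ball 0 R - {0}|lborel. radial_pow R x (of_nat (DIM('a) - 1) - a) y)
    = (LINT y:ball 0 R - {0}|lborel. radial_pow R x a y)"
proof -
  obtain \<iota> :: "real ^ 'a dim_index \<Rightarrow> 'a"
    where \<iota>: "linear \<iota>" "bij \<iota>" "\<And>u v. \<iota> u \<bullet> \<iota> v = u \<bullet> v" "distr lborel borel \<iota> = lborel"
    using ex_isometry_dim_index by blast
  obtain z where z: "\<iota> z = x" using bij_is_surj[OF \<iota>(2)] by (metis surjD)
  have norm: "norm (\<iota> v) = norm v" for v by (simp add: norm_eq_sqrt_inner \<iota>(3))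
  have zR: "norm z \<noteq> R" using xR norm[of z] z by simp
  have meas: "\<iota> \<in> borel_measurable lborel"
    using linear_conv_bounded_linear[THEN iffD1, OF \<iota>(1)]
    by (simp add: borel_measurable_continuous_onI linear_continuous_on)
  have ind: "indicator (ball 0 R - {0}) (\<iota> v) = (indicator (ball 0 R - {0}) v :: real)" for v
  proof -
    have "\<iota> v = 0 \<longleftrightarrow> v = 0" using norm[of v] by (metis norm_eq_zero)
    thus ?thesis by (simp add: indicator_def norm)
  qed
  have pow: "radial_pow R x b (\<iota> v) = radial_pow R z b v" for b v
    unfolding radial_pow_def omega_pow_def omega_def z[symmetric] norm
    by (simp add: norm flip: linear_scale[OF \<iota>(1)] linear_diff[OF \<iota>(1)])
  have "(LINT y:ball 0 R - {0}|lborel. radial_pow R x b y)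
      = (LINT v:ball 0 R - {0}|lborel. radial_pow R z b v)" for b
  proof -
    have "(\<lambda>y. indicator (ball 0 R - {0}) y *\<^sub>R radial_pow R x b y) \<in> borel_measurable borel"
      using radial_pow_set_integrable[OF R xR, of b] unfolding set_integrable_def
      by (auto dest: borel_measurable_integrable)
    hence "(LINT y:ball 0 R - {0}|distr lborel borel \<iota>. radial_pow R x b y)
      = (LINT v:ball 0 R - {0}|lborel. radial_pow R z b v)"
      unfolding set_lebesgue_integral_def
      by (subst integral_distr) (use meas in \<open>auto simp: ind pow\<close>)
    thus ?thesis unfolding \<iota>(4) .
  qed
  thus ?thesis using integral_radial_pow_reflect_cart[OF R zR, of a] by simp
qed

text \<open>Unfolds the push-forward. The centre, where the radial projection has the default value
  0, may be removed because it is a null set.\<close>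

lemma integral_sphere_measure:
  fixes x :: "'a::euclidean_space"
  assumes R: "R > 0"
  shows "(\<integral>y. omega_pow x y a \<partial>(sphere_measure R :: 'a measure))
    = (real DIM('a) / R) *\<^sub>R (LINT y:ball 0 R - {0}|lborel. radial_pow R x a y)"
proof -
  let ?P = "\<lambda>y::'a. (R / norm y) *\<^sub>R y"
  define M where "M = distr (restrict_space lborel (ball 0 R)) borel ?P"
  define c where "c = real DIM('a) / R"
  have c: "c \<ge> 0" using R by (simp add: c_def)
  have P: "?P \<in> measurable (restrict_space lborel (ball 0 R)) borel"
    by (rule measurable_restrict_space1) measurable
  \<comment> \<open>Read as a constant density, the scaling becomes a scalar factor of the
    integral.\<close>
  have "scale_measure (ennreal c) M = density M (\<lambda>_. ennreal c)"
    by (rule measure_eqI) (auto simp: emeasure_density_const)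
  hence "(\<integral>y. omega_pow x y a \<partial>(sphere_measure R)) = (\<integral>y. omega_pow x y a \<partial>(density M (\<lambda>_. ennreal c)))"
    by (simp add: sphere_measure_def M_def c_def)
  also have "\<dots> = (\<integral>y. c *\<^sub>R omega_pow x y a \<partial>M)"
    by (rule integral_density) (auto simp: c M_def)
  also have "\<dots> = c *\<^sub>R (\<integral>y. omega_pow x y a \<partial>M)" by simp
  also have "(\<integral>y. omega_pow x y a \<partial>M) = (\<integral>y. radial_pow R x a y \<partial>restrict_space lborel (ball 0 R))"
    unfolding M_def radial_pow_def by (rule integral_distr[OF P]) measurable
  also have "\<dots> = (\<integral>y. indicator (ball 0 R) y *\<^sub>R radial_pow R x a y \<partial>lborel)"
    by (rule integral_restrict_space) auto
  also have "\<dots> = (LINT y:ball 0 R - {0}|lborel. radial_pow R x a y)"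
    unfolding set_lebesgue_integral_def
  proof (rule integral_cong_AE)
    have "radial_pow R x a \<in> borel_measurable lborel"
      unfolding radial_pow_def[abs_def] by measurable
    thus "(\<lambda>y. indicat_real (ball 0 R) y *\<^sub>R radial_pow R x a y) \<in> borel_measurable lborel"
      "(\<lambda>y. indicat_real (ball 0 R - {0}) y *\<^sub>R radial_pow R x a y) \<in> borel_measurable lborel"
      by (intro borel_measurable_scaleR borel_measurable_indicator; simp)+
    show "AE y in lborel. indicat_real (ball 0 R) y *\<^sub>R radial_pow R x a y
        = indicat_real (ball 0 R - {0}) y *\<^sub>R radial_pow R x a y"
      using AE_lborel_singleton[of "0::'a"] by eventually_elim (auto simp: indicator_def)
  qed
  finally show ?thesis by (simp add: c_def)
qed

section \<open>From the symmetry of the integrals to the exponents\<close>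

theorem theorem1:
  fixes x :: "'a::euclidean_space" and R :: real and \<alpha> \<beta> :: complex
  assumes R_pos: "R > 0"
    and x_ne0: "norm x \<noteq> 0"
    and x_neR: "norm x \<noteq> R"
    and Im_bound: "max \<bar>Im \<alpha>\<bar> \<bar>Im \<beta>\<bar>
                    \<le> (pi / 2) / ln ((R + norm x) / \<bar>R - norm x\<bar>)"
    and eq: "(\<integral>y. omega_pow x y \<alpha> \<partial>(sphere_measure R :: 'a measure))
           = (\<integral>y. omega_pow x y \<beta> \<partial>(sphere_measure R :: 'a measure))"
  shows "\<alpha> + \<beta> = of_nat (DIM('a) - 1) \<or> \<alpha> = \<beta>"
proof (rule ccontr)
  define k :: complex where "k = of_nat (DIM('a) - 1)"
  define p where "p = (\<alpha> + \<beta> - k) / 2"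
  define q where "q = (\<alpha> - \<beta>) / 2"
  define L where "L = ln ((R + norm x) / \<bar>R - norm x\<bar>)"
  define S where "S = ball (0::'a) R - {0}"
  define W where "W = radial_omega R x"
  define J where "J a = (LINT y:S|lborel. radial_pow R x a y)" for a
  assume "\<not> (\<alpha> + \<beta> = of_nat (DIM('a) - 1) \<or> \<alpha> = \<beta>)"
  hence pq: "p \<noteq> 0" "q \<noteq> 0" by (auto simp: p_def q_def k_def)
  have "(R + norm x) / \<bar>R - norm x\<bar> > 1"
    using R_pos x_ne0 x_neR by (auto simp: divide_simps abs_if)
  hence L: "L > 0" by (simp add: L_def)
  \<comment> \<open>As \<open>k\<close> is real, this rests on
    \<open>(\<bar>a + b\<bar> + \<bar>a - b\<bar>) / 2\<close> being the maximum of
    \<open>\<bar>a\<bar>\<close> and \<open>\<bar>b\<bar>\<close>; the assumed bound thus becomes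
    the one required for the hyperbolic sines.\<close>
  have "\<bar>Im p\<bar> + \<bar>Im q\<bar> \<le> max \<bar>Im \<alpha>\<bar> \<bar>Im \<beta>\<bar>"
  proof -
    have "\<bar>a + b\<bar> / 2 + \<bar>a - b\<bar> / 2 \<le> max \<bar>a\<bar> \<bar>b\<bar>" for a b :: real
      by (auto simp: max_def abs_if field_simps)
    thus ?thesis by (simp add: p_def q_def k_def)
  qed
  also have "\<dots> \<le> (pi / 2) / L" using Im_bound by (simp only: L_def)
  finally have "(\<bar>Im p\<bar> + \<bar>Im q\<bar>) * L \<le> pi / 2" using L by (simp add: field_simps)
  then obtain \<epsilon> where \<epsilon>:
    "\<And>u::real. 0 < \<bar>u\<bar> \<Longrightarrow> \<bar>u\<bar> \<le> L \<Longrightarrow> Re (\<epsilon> * (sinh (p * u) * sinh (q * u))) > 0"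
    using sinh_product_one_signed[OF pq] by blast
  \<comment> \<open>Pairing each power with its reflection keeps the integral of the difference zero
    and makes the integrand factor.\<close>
  define h where "h y = radial_pow R x \<alpha> y + radial_pow R x (k - \<alpha>) y
    - radial_pow R x \<beta> y - radial_pow R x (k - \<beta>) y" for y
  define H where "H y = indicator S y *\<^sub>R Re (\<epsilon> * h y)" for y
  note int = radial_pow_set_integrable[OF R_pos x_neR, folded S_def]
  have "J \<alpha> = J \<beta>"
    using eq R_pos unfolding integral_sphere_measure[OF R_pos] J_def S_def by simp
  moreover have "J (k - a) = J a" for a
    unfolding J_def S_def k_def by (rule integral_radial_pow_reflect[OF R_pos x_neR])
  ultimately have "(LINT y:S|lborel. h y) = 0"
    unfolding h_def by (simp add: set_integral_add set_integral_diff int J_def)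
  have h_int: "integrable lborel (\<lambda>y. indicator S y *\<^sub>R h y)"
    unfolding h_def set_integrable_def[symmetric]
    by (intro set_integral_add set_integral_diff int)
  have H_eq: "H y = Re (\<epsilon> * (indicator S y *\<^sub>R h y))" for y
    by (simp add: H_def indicator_def)
  have H_int: "integrable lborel H"
    unfolding H_eq[abs_def] using h_int by (intro integrable_Re integrable_mult_right)
  have "(\<integral>y. H y \<partial>lborel) = Re (\<integral>y. \<epsilon> * (indicator S y *\<^sub>R h y) \<partial>lborel)"
    unfolding H_eq by (rule integral_Re) (intro integrable_mult_right h_int)
  also have "\<dots> = Re (\<epsilon> * (LINT y:S|lborel. h y))"
    unfolding set_lebesgue_integral_def by (subst integral_mult_right_zero) (rule refl)
  finally have "(\<integral>y. H y \<partial>lborel) = Re (\<epsilon> * (LINT y:S|lborel. h y))" .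
  hence H_0: "(\<integral>y. H y \<partial>lborel) = 0" using \<open>(LINT y:S|lborel. h y) = 0\<close> by simp
  \<comment> \<open>Each pair equals \<open>2 * exp (k * u / 2)\<close> times a hyperbolic cosine,
    of \<open>(\<alpha> - k / 2) * u\<close> or \<open>(\<beta> - k / 2) * u\<close>; a difference
    of hyperbolic cosines is twice a product of hyperbolic sines.\<close>
  have h_eq: "h y = 4 * exp (k / 2 * of_real u) * (sinh (p * of_real u) * sinh (q * of_real u))"
    if "u = ln (W y)" for y u
  proof -
    have "4 * exp (k / 2 * z) * (sinh (p * z) * sinh (q * z))
      = exp (\<alpha> * z) + exp ((k - \<alpha>) * z) - exp (\<beta> * z) - exp ((k - \<beta>) * z)" for z :: complex
    proof -
      have "4 * exp (k / 2 * z) * (sinh (p * z) * sinh (q * z))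
        = exp (k / 2 * z) * exp (p * z) * exp (q * z) + exp (k / 2 * z) * exp (- (p * z)) * exp (- (q * z))
        - exp (k / 2 * z) * exp (p * z) * exp (- (q * z)) - exp (k / 2 * z) * exp (- (p * z)) * exp (q * z)"
        by (simp add: sinh_def scaleR_conv_of_real field_simps)
      also have "\<dots> = exp (\<alpha> * z) + exp ((k - \<alpha>) * z) - exp (\<beta> * z) - exp ((k - \<beta>) * z)"
      proof -
        have "k / 2 * z + p * z + q * z = \<alpha> * z" "k / 2 * z + - (p * z) + - (q * z) = (k - \<alpha>) * z"
          "k / 2 * z + p * z + - (q * z) = \<beta> * z" "k / 2 * z + - (p * z) + q * z = (k - \<beta>) * z"
          by (simp_all add: p_def q_def field_simps)
        thus ?thesis unfolding exp_add[symmetric] by simp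
      qed
      finally show ?thesis .
    qed
    thus ?thesis by (simp add: h_def radial_pow_eq W_def that)
  qed
  have H_pos: "H y > 0" if "y \<in> S" "W y \<noteq> 1" for y
  proof -
    define u where "u = ln (W y)"
    have y: "y \<noteq> 0" using that by (simp add: S_def)
    have "W y > 0" unfolding W_def by (rule radial_omega_pos[OF R_pos x_neR y])
    hence "u \<noteq> 0" using that by (simp add: u_def)
    moreover have "\<bar>u\<bar> \<le> L"
      unfolding u_def W_def L_def by (rule abs_ln_radial_omega_le[OF R_pos x_neR y])
    ultimately have "Re (\<epsilon> * (sinh (p * u) * sinh (q * u))) > 0" using \<epsilon> by simp
    \<comment> \<open>Since \<open>k\<close> and \<open>u\<close> are real, the exponential is a
      positive real number and can leave the real part.\<close>
    moreover have "\<epsilon> * h y = of_real (4 * exp (real (DIM('a) - 1) / 2 * u)) * (\<epsilon> * (sinh (p * u) * sinh (q * u)))"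
      unfolding h_eq[OF u_def] k_def by (simp add: exp_of_real[symmetric])
    hence "Re (\<epsilon> * h y) = 4 * exp (real (DIM('a) - 1) / 2 * u) * Re (\<epsilon> * (sinh (p * u) * sinh (q * u)))"
      by (simp only: Re_complex_of_real Im_complex_of_real times_complex.sel mult_zero_left diff_zero)
    ultimately show ?thesis using that by (simp add: H_def del: times_complex.sel)
  qed
  \<comment> \<open>Where \<open>W y = 1\<close> the logarithm is 0, so both hyperbolic sines
    vanish; outside \<open>S\<close> the indicator does.\<close>
  have "H y \<ge> 0" for y
  proof (cases "y \<in> S \<and> W y \<noteq> 1")
    case True thus ?thesis using H_pos[of y] by simp
  next
    case False thus ?thesis using h_eq[of 0 y] by (auto simp: H_def)
  qed
  hence "AE y in lborel. H y = 0"
    using integral_nonneg_eq_0_iff_AE[OF H_int] H_0 by simp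
  hence AE: "AE y in lborel. y \<notin> {y \<in> S. W y \<noteq> 1}"
    by eventually_elim (use H_pos in force)
  \<comment> \<open>A nonnegative function with integral zero vanishes almost everywhere, so
    \<open>U\<close> is null; being open, it would have to be empty.\<close>
  define U where "U = {y \<in> S. W y \<noteq> 1}"
  have "U = S \<inter> (W -` (- {1}))" by (auto simp: U_def)
  moreover have "open S" by (auto simp: S_def open_delete)
  moreover have "continuous_on S W" unfolding W_def
    by (rule continuous_on_subset[OF continuous_on_radial_omega[OF R_pos x_neR]]) (auto simp: S_def)
  ultimately have "open U"
    by (simp add: continuous_open_preimage open_Compl)
  \<comment> \<open>This \<open>y\<close> projects to the point of the sphere nearest to
    \<open>x\<close>, where \<open>omega\<close> takes its largest value
    \<open>(R + norm x) / \<bar>R - norm x\<bar>\<close>, which exceeds 1 because \<open>x\<close>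
    is not the centre.\<close>
  define y where "y = (R / (2 * norm x)) *\<^sub>R x"
  have "y \<in> S" using R_pos x_ne0 by (auto simp: y_def S_def)
  moreover have "W y \<noteq> 1"
  proof
    assume "W y = 1"
    have "norm x > 0" using x_ne0 by simp
    have "x - (R / norm y) *\<^sub>R y = (1 - R / norm x) *\<^sub>R x"
      using R_pos x_ne0 by (simp add: y_def algebra_simps)
    hence "norm (x - (R / norm y) *\<^sub>R y) = \<bar>norm x - R\<bar>"
      using \<open>norm x > 0\<close> by (simp add: divide_simps abs_if)
    moreover have "norm ((R / norm y) *\<^sub>R y) = R"
      using R_pos x_ne0 by (simp add: y_def)
    ultimately have "\<bar>(norm x)\<^sup>2 - R\<^sup>2\<bar> = (norm x - R)\<^sup>2"
      using \<open>W y = 1\<close> x_neR by (simp add: W_def radial_omega_def omega_def abs_div)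
    hence "(norm x + R) * \<bar>norm x - R\<bar> = \<bar>norm x - R\<bar> * \<bar>norm x - R\<bar>"
      using R_pos by (simp add: square_diff_square_factored power2_eq_square abs_mult)
    hence "norm x + R = \<bar>norm x - R\<bar>"
      using x_neR by (simp only: mult.commute[of "norm x + R"] mult_cancel_left) simp
    thus False using R_pos \<open>norm x > 0\<close> by linarith
  qed
  ultimately have "y \<in> U" by (simp add: U_def)
  have "U \<in> null_sets lborel"
    using AE \<open>open U\<close> by (subst AE_iff_null_sets) (auto simp: U_def)
  hence "negligible U"
    by (simp add: negligible_iff_null_sets null_sets_completionI)
  thus False using open_not_negligible[OF \<open>open U\<close>] \<open>y \<in> U\<close> by blast
qed

end
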